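(* Let $i^*\in[n]$, $\rho\ge0$ and $x^*\in\arg\min_{x\in\mathcal{X}}F^{(\{i^*\},[m])}(x)$. If $$\min_{x\in\mathcal{X}}F^{(\{i\},[m])}(x)=\nu^{(i)}\ \ge\ \nu^{(i^* )}=F^{(\{i^*\},[m])}(x^* )\qquad\forall\, i\in\mathcal{A}_\rho(x^* ),$$ then $x^*$ is a local optimum of the problem $\min_{x\in\mathcal{X}}F(x)$.
   Context: Let $n,m\in\mathbb{N}$, $[N]:=\{1,\dots,N\}$, and $\mathcal{X}\subseteq\mathbb{R}^d$. Let $f^{(i)}:\mathbb{R}^d\to\mathbb{R}\cup\{\infty\}$, $i\in[n]$ (the "pieces") and $c^{(j)}:\mathbb{R}^d\to\mathbb{R}$, $j\in[m]$ (the "constraints") be given. Write $\mathrm{dom}\,h:=\{x\in\mathbb{R}^d: h(x)<\infty\}$. For $S\subseteq[m]$ let $\mathcal{D}^{(S)}:=\{x\in\mathbb{R}^d : c^{(j)}(x)\le 0\ \forall j\in S\}$. For nonempty $H\subseteq[n]$ and $S\subseteq[m]$ let $F^{(H,S)}(x):=\min_{i\in H}f^{(i)}(x)$ if $x\in\mathcal{D}^{(S)}$ and $F^{(H,S)}(x):=\infty$ otherwise. Set $F:=F^{([n],[m])}$, $F^*:=\min_{x\in\mathcal{X}}F(x)$, $\nu(H,S):=\min_{x\in\mathcal{X}}F^{(H,S)}(x)$ and $\nu^{(i)}:=\nu(\{i\},[m])$. Standing assumptions: $-\infty<F^*<\infty$. For every nonempty $H\subseteq[n]$ and every $S\subseteq[m]$,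 the minimum $\nu(H,S)$ is attained at some point $x^*(H,S)\in\mathcal{X}\cap\mathcal{D}^{(S)}$, i.e. $\min_{i\in H}f^{(i)}(x^*(H,S))=\nu(H,S)$. For every $i\in[n]$, $f^{(i)}$ is continuous and convex on its domain, and $\mathcal{X}\subseteq\mathrm{dom}\,f^{(i)}$. For $\rho\ge0$ and $x\in\mathcal{X}$, the $\rho$-active set is $\mathcal{A}_\rho(x):=\{i\in[n]: f^{(i)}(x)\le\min_{l\in[n]}f^{(l)}(x)+\rho\}$. A point $\hat{x}\in\mathcal{X}$ is a local optimum (local minimum) if $F(\hat{x})<\infty$ and there is $\alpha>0$ such that $F(\hat{x})=\min\{F(x): x\in\mathcal{X},\ \|x-\hat{x}\|_2\le\alpha\}$. *)

theory Defs
  imports "HOL-Analysis.Analysis"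
begin

definition eff_dom :: "(real ^ 'd \<Rightarrow> ereal) \<Rightarrow> (real ^ 'd) set"
  where "eff_dom h = {x. h x < \<infinity>}"

definition feasible :: "(nat \<Rightarrow> real ^ 'd \<Rightarrow> real) \<Rightarrow> nat set \<Rightarrow> (real ^ 'd) set"
  where "feasible c S = {x. \<forall>j\<in>S. c j x \<le> 0}"

definition piece_min :: "(nat \<Rightarrow> real ^ 'd \<Rightarrow> ereal) \<Rightarrow> nat set \<Rightarrow> real ^ 'd \<Rightarrow> ereal"
  where "piece_min f H x = Min ((\<lambda>i. f i x) ` H)"

definition objective ::
    "(nat \<Rightarrow> real ^ 'd \<Rightarrow> ereal) \<Rightarrow> (nat \<Rightarrow> real ^ 'd \<Rightarrow> real) \<Rightarrow> nat set \<Rightarrow> nat set \<Rightarrow> real ^ 'd \<Rightarrow> ereal"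
  where "objective f c H S x = (if x \<in> feasible c S then piece_min f H x else \<infinity>)"

text \<open>The value is written as an infimum in the complete lattice \<^typ>\<open>ereal\<close>; it is the
  minimum whenever it is attained, which has to be assumed where it is used.\<close>

definition opt_value ::
    "(nat \<Rightarrow> real ^ 'd \<Rightarrow> ereal) \<Rightarrow> (nat \<Rightarrow> real ^ 'd \<Rightarrow> real) \<Rightarrow> (real ^ 'd) set \<Rightarrow> nat set \<Rightarrow> nat set \<Rightarrow> ereal"
  where "opt_value f c X H S = (INF x\<in>X. objective f c H S x)"

definition active_set :: "nat \<Rightarrow> (nat \<Rightarrow> real ^ 'd \<Rightarrow> ereal) \<Rightarrow> real \<Rightarrow> real ^ 'd \<Rightarrow> nat set"
  where "active_set n f \<rho> x = {i \<in> {1..n}. f i x \<le> piece_min f {1..n} x + ereal \<rho>}"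

text \<open>Since the point \<open>z\<close> itself lies in the set over which the infimum is taken, the
  equation says that \<open>G z\<close> is the minimum over that set.\<close>

definition local_optimum :: "(real ^ 'd \<Rightarrow> ereal) \<Rightarrow> (real ^ 'd) set \<Rightarrow> real ^ 'd \<Rightarrow> bool"
  where "local_optimum G X z \<longleftrightarrow>
    z \<in> X \<and> G z < \<infinity> \<and> (\<exists>\<alpha>>0. G z = (INF x\<in>{x \<in> X. norm (x - z) \<le> \<alpha>}. G x))"

end

theory Submission
  imports Defs
begin

text \<open>A piece attaining \<open>min_l f l xstar\<close> is active, so its optimal value, and hence that minimum, is
  at least \<open>\<nu> istar = f istar xstar\<close>; thus \<open>F xstar = \<nu> istar\<close>. Near \<open>xstar\<close> the inactive pieces stay
  above this value by continuity, while the active ones do so on the whole feasible set because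
  their optimal values are at least \<open>\<nu> istar\<close>.\<close>

lemma piece_min_singleton [simp]: "piece_min f {i} x = f i x"
  by (simp add: piece_min_def)

lemma opt_value_le:
  assumes "x \<in> X" "x \<in> feasible c S"
  shows "opt_value f c X {i} S \<le> f i x"
  using INF_lower[OF assms(1), of "objective f c {i} S"] assms(2)
  by (simp add: opt_value_def objective_def)

text \<open>The filter form lets the neighbourhoods of the separate pieces be intersected without
  choosing radii. The filter \<open>at z within X\<close> leaves out \<open>z\<close> itself, where
  the inequality is trivial, and \<open>eventually_at_le\<close> yields the closed ball that
  \<open>local_optimum\<close> asks for.\<close>

lemma local_optimumI:
  assumes "z \<in> X" "G z < \<infinity>" and ev: "eventually (\<lambda>x. G z \<le> G x) (at z within X)"
  shows "local_optimum G X z"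
proof -
  obtain \<alpha> where \<alpha>: "\<alpha> > 0" "\<And>x. x \<in> X \<Longrightarrow> x \<noteq> z \<Longrightarrow> dist x z \<le> \<alpha> \<Longrightarrow> G z \<le> G x"
    using ev unfolding eventually_at_le by blast
  have "G z = (INF x\<in>{x \<in> X. norm (x - z) \<le> \<alpha>}. G x)"
  proof (rule antisym)
    show "G z \<le> (INF x\<in>{x \<in> X. norm (x - z) \<le> \<alpha>}. G x)"
    proof (rule INF_greatest)
      fix x assume "x \<in> {x \<in> X. norm (x - z) \<le> \<alpha>}"
      then show "G z \<le> G x" using \<alpha>(2)[of x] by (cases "x = z") (auto simp: dist_norm)
    qed
    show "(INF x\<in>{x \<in> X. norm (x - z) \<le> \<alpha>}. G x) \<le> G z"
      by (rule INF_lower) (use assms(1) \<alpha>(1) in auto)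
  qed
  with assms(1,2) \<alpha>(1) show ?thesis unfolding local_optimum_def by blast
qed

theorem lemma2p3:
  fixes n m :: nat
    and X :: "(real ^ 'd) set"
    and f :: "nat \<Rightarrow> real ^ 'd \<Rightarrow> ereal"
    and c :: "nat \<Rightarrow> real ^ 'd \<Rightarrow> real"
    and istar :: nat and \<rho> :: real and xstar :: "real ^ 'd"
  assumes f_not_MInf: "\<And>i x. i \<in> {1..n} \<Longrightarrow> f i x \<noteq> -\<infinity>"
    and Fstar_finite: "-\<infinity> < opt_value f c X {1..n} {1..m}" "opt_value f c X {1..n} {1..m} < \<infinity>"
    and attained: "\<And>H S. H \<noteq> {} \<Longrightarrow> H \<subseteq> {1..n} \<Longrightarrow> S \<subseteq> {1..m} \<Longrightarrow>
      \<exists>x \<in> X \<inter> feasible c S. piece_min f H x = opt_value f c X H S"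
    and f_continuous: "\<And>i. i \<in> {1..n} \<Longrightarrow> continuous_on (eff_dom (f i)) (f i)"
    and f_convex: "\<And>i. i \<in> {1..n} \<Longrightarrow> convex_on (eff_dom (f i)) (\<lambda>x. real_of_ereal (f i x))"
    and X_subset_dom: "\<And>i. i \<in> {1..n} \<Longrightarrow> X \<subseteq> eff_dom (f i)"
    and istar: "istar \<in> {1..n}"
    and rho: "\<rho> \<ge> 0"
    and xstar: "is_arg_min (objective f c {istar} {1..m}) (\<lambda>x. x \<in> X) xstar"
    and active: "\<And>i. i \<in> active_set n f \<rho> xstar \<Longrightarrow>
      opt_value f c X {i} {1..m} \<ge> opt_value f c X {istar} {1..m} \<and>
      opt_value f c X {istar} {1..m} = objective f c {istar} {1..m} xstar"
  shows "local_optimum (objective f c {1..n} {1..m}) X xstar"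
proof -
  let ?F = "objective f c {1..n} {1..m}"
  let ?v = "opt_value f c X {istar} {1..m}"
  \<comment> \<open>The point \<open>y\<close> shows that \<open>?v\<close> is below \<infinity>.
    This forces \<open>xstar\<close> to be feasible, since an infeasible minimiser would have
    objective value \<infinity>.\<close>
  obtain y where y: "y \<in> X" "y \<in> feasible c {1..m}" "f istar y = ?v"
    using attained[of "{istar}" "{1..m}"] istar by auto
  have xX: "xstar \<in> X" and xmin: "\<And>x. x \<in> X \<Longrightarrow>
      objective f c {istar} {1..m} xstar \<le> objective f c {istar} {1..m} x"
    using xstar by (auto simp: is_arg_min_def not_less)
  have "objective f c {istar} {1..m} xstar \<le> f istar y"
    using xmin[OF y(1)] y(2) by (simp add: objective_def)
  moreover have "f istar y < \<infinity>"
    using X_subset_dom[OF istar] y(1) by (auto simp: eff_dom_def)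
  ultimately have feas: "xstar \<in> feasible c {1..m}" and le: "f istar xstar \<le> ?v"
    using y(3) by (auto simp: objective_def split: if_splits)
  have "piece_min f {1..n} xstar \<in> (\<lambda>i. f i xstar) ` {1..n}"
    unfolding piece_min_def using istar by (intro Min_in) auto
  then obtain k where k: "k \<in> {1..n}" "piece_min f {1..n} xstar = f k xstar" by blast
  then have "k \<in> active_set n f \<rho> xstar"
    using rho by (simp add: active_set_def add_increasing2)
  then have "?v \<le> opt_value f c X {k} {1..m}" using active by blast
  also have "\<dots> \<le> f k xstar" by (rule opt_value_le[OF xX feas])
  finally have "?v \<le> piece_min f {1..n} xstar" using k(2) by simp
  moreover have "piece_min f {1..n} xstar \<le> f istar xstar"
    unfolding piece_min_def using istar by (intro Min_le) auto
  \<comment> \<open>The chain closes up through \<open>le\<close>, so \<open>istar\<close> is itself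
    a minimising piece at \<open>xstar\<close>.\<close>
  ultimately have pm: "piece_min f {1..n} xstar = ?v" using le by simp
  then have Fv: "?F xstar = ?v" using feas by (simp add: objective_def)
  \<comment> \<open>The bound is restricted to feasible points: \<open>opt_value\<close> controls
    active pieces only there, and elsewhere the objective is \<infinity>.\<close>
  have near: "eventually (\<lambda>x. x \<in> feasible c {1..m} \<longrightarrow> ?v \<le> f i x) (at xstar within X)"
    if i: "i \<in> {1..n}" for i
  proof (cases "i \<in> active_set n f \<rho> xstar")
    case True
    have "?v \<le> f i x" if "x \<in> X" "x \<in> feasible c {1..m}" for x
      using active[OF True] opt_value_le[OF that, of f i] by (meson order_trans)
    then show ?thesis unfolding eventually_at_filter by simp
  next
    case False
    \<comment> \<open>By \<open>pm\<close> the activity threshold is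
      \<open>?v + ereal \<rho>\<close>, so inactivity gives the strict gap that the limit argument
      requires.\<close>
    have "?v \<le> ?v + ereal \<rho>" using rho by (simp add: add_increasing2)
    also have "\<dots> < f i xstar" using False i pm by (simp add: active_set_def not_le)
    finally have gt: "?v < f i xstar" .
    \<comment> \<open>Continuity is given on the effective domain, which contains \<open>X\<close>;
      hence the limit is taken within \<open>X\<close>.\<close>
    have "(f i \<longlongrightarrow> f i xstar) (at xstar within X)"
      using continuous_on_subset[OF f_continuous[OF i] X_subset_dom[OF i]] xX
      by (simp add: continuous_on_def)
    from order_tendstoD(1)[OF this gt] show ?thesis
      by (rule eventually_mono) (simp add: less_imp_le)
  qed
  \<comment> \<open>Only finitely many pieces occur, so one neighbourhood serves them all.\<close>
  have "eventually (\<lambda>x. \<forall>i\<in>{1..n}. x \<in> feasible c {1..m} \<longrightarrow> ?v \<le> f i x) (at xstar within X)"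
    using near by (intro eventually_ball_finite) auto
  then have "eventually (\<lambda>x. ?F xstar \<le> ?F x) (at xstar within X)"
  proof (rule eventually_mono)
    fix x assume "\<forall>i\<in>{1..n}. x \<in> feasible c {1..m} \<longrightarrow> ?v \<le> f i x"
    then show "?F xstar \<le> ?F x"
      unfolding Fv using istar by (auto simp: objective_def piece_min_def)
  qed
  moreover have "?F xstar < \<infinity>"
    using Fv y(3) \<open>f istar y < \<infinity>\<close> by simp
  ultimately show ?thesis by (intro local_optimumI xX)
qed

end
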